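(* There exists a polycyclic subgroup $\Gamma\subset GL(3,\mathbb{Z})$ such that the natural action $\alpha$ of $\Gamma$ on $\mathbb{T}^3=\mathbb{R}^3/\mathbb{Z}^3$ is expansive but admits a non-trivial quotient on which the induced $\Gamma$-action is trivial; that is, there is a closed $\Gamma$-invariant subgroup $K\subsetneq\mathbb{T}^3$ such that $\Gamma$ acts trivially on $\mathbb{T}^3/K$. In particular, $\alpha$ is an expansive algebraic action of a polycyclic group on a connected group which is not ergodic with respect to Haar measure.
   Context: The natural action of a subgroup $\Gamma\subset GL(3,\mathbb{Z})$ on $\mathbb{T}^3=\mathbb{R}^3/\mathbb{Z}^3$ is the action by continuous automorphisms induced by matrix multiplication on column vectors in $\mathbb{R}^3$. An action $\alpha$ of a countable group $\Gamma$ on a compact metrizable abelian group $X$ by continuous automorphisms is expansive if there is a neighbourhood $U$ of $0$ in $X$ such that $\bigcap_{\gamma\in\Gamma}\alpha(\gamma)(U)=\{0\}$. It is ergodic if every Borel set $E\subset X$ that is invariant under all $\alpha(\gamma)$ modulo Haar-null sets has normalized Haar measure $0$ or $1$. If $K\subset X$ is a closed $\Gamma$-invariant subgroup, the induced action on $X/K$ is $\gamma\cdot(x+K)=\alpha(\gamma)(x)+K$. *)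

theory Defs
  imports
    "HOL-Analysis.Analysis"
    "HOL-Algebra.Coset"
    "HOL-Algebra.Elementary_Groups"
begin

section \<open>Actions on topological abelian groups\<close>

definition continuous_automorphism :: "('a::topological_ab_group_add \<Rightarrow> 'a) \<Rightarrow> bool" where
  "continuous_automorphism f \<longleftrightarrow>
     (\<forall>x y. f (x + y) = f x + f y) \<and> (\<exists>g. homeomorphism UNIV UNIV f g)"

definition algebraic_action ::
  "('g, 'm) monoid_scheme \<Rightarrow> ('g \<Rightarrow> 'a::topological_ab_group_add \<Rightarrow> 'a) \<Rightarrow> bool" where
  "algebraic_action G \<alpha> \<longleftrightarrow>
     group G \<and> countable (carrier G) \<and>
     compact (UNIV :: 'a set) \<and> metrizable_space (euclidean :: 'a topology) \<and>
     (\<forall>g\<in>carrier G. continuous_automorphism (\<alpha> g)) \<and>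
     \<alpha> \<one>\<^bsub>G\<^esub> = id \<and>
     (\<forall>g\<in>carrier G. \<forall>h\<in>carrier G. \<alpha> (g \<otimes>\<^bsub>G\<^esub> h) = \<alpha> g \<circ> \<alpha> h)"

definition expansive_action ::
  "('g, 'm) monoid_scheme \<Rightarrow> ('g \<Rightarrow> 'a::topological_ab_group_add \<Rightarrow> 'a) \<Rightarrow> bool" where
  "expansive_action G \<alpha> \<longleftrightarrow>
     (\<exists>U. 0 \<in> interior U \<and> (\<Inter>g\<in>carrier G. \<alpha> g ` U) = {0})"

definition normalized_haar :: "'a::topological_ab_group_add measure \<Rightarrow> bool" where
  "normalized_haar \<mu> \<longleftrightarrow>
     sets \<mu> = sets borel \<and> emeasure \<mu> UNIV = 1 \<and> (\<forall>x. distr \<mu> borel ((+) x) = \<mu>)"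

text \<open>Well defined for the torus by \<open>normalized_haar_ex1\<close> below; uniqueness holds in every
  second countable group (\<open>normalized_haar_unique\<close>).\<close>

definition haar :: "'a::topological_ab_group_add measure" where
  "haar = (THE \<mu>. normalized_haar \<mu>)"

definition ergodic_action ::
  "('g, 'm) monoid_scheme \<Rightarrow> ('g \<Rightarrow> 'a::topological_ab_group_add \<Rightarrow> 'a) \<Rightarrow> bool" where
  "ergodic_action G \<alpha> \<longleftrightarrow>
     (\<forall>E\<in>sets borel.
        (\<forall>g\<in>carrier G. (\<alpha> g ` E - E) \<union> (E - \<alpha> g ` E) \<in> null_sets haar) \<longrightarrow>
        emeasure haar E = 0 \<or> emeasure haar E = 1)"

definition closed_invariant_subgroup ::
  "('g, 'm) monoid_scheme \<Rightarrow> ('g \<Rightarrow> 'a::topological_ab_group_add \<Rightarrow> 'a) \<Rightarrow> 'a set \<Rightarrow> bool" where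
  "closed_invariant_subgroup G \<alpha> K \<longleftrightarrow>
     closed K \<and> 0 \<in> K \<and> (\<forall>x\<in>K. \<forall>y\<in>K. x + y \<in> K) \<and> (\<forall>x\<in>K. - x \<in> K) \<and>
     (\<forall>g\<in>carrier G. \<alpha> g ` K \<subseteq> K)"

text \<open>The set of cosets \<open>x + K\<close>, and the map \<open>x + K \<mapsto> f x + K\<close> induced by \<open>f\<close>.\<close>

definition cosets :: "'a::ab_group_add set \<Rightarrow> 'a set set" where
  "cosets K = range (\<lambda>x. x +o K)"

definition induced_map :: "('a::ab_group_add \<Rightarrow> 'a) \<Rightarrow> 'a set \<Rightarrow> 'a set \<Rightarrow> 'a set" where
  "induced_map f K C = (\<Union>x\<in>C. f x +o K)"

lemma induced_map_coset:
  assumes K: "0 \<in> K" "\<And>x y. x \<in> K \<Longrightarrow> y \<in> K \<Longrightarrow> x + y \<in> K"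
    and inv: "f ` K \<subseteq> K" and add: "\<And>x y. f (x + y) = f x + f y"
  shows "induced_map f K (x +o K) = f x +o K"
proof (intro equalityI subsetI)
  fix z assume "z \<in> induced_map f K (x +o K)"
  then obtain k l where kl: "k \<in> K" "l \<in> K" "z = f (x + k) + l"
    by (auto simp: induced_map_def elt_set_plus_def)
  then have "z = f x + (f k + l)" "f k + l \<in> K"
    using inv K by (auto simp: add add.assoc)
  then show "z \<in> f x +o K" by (auto simp: elt_set_plus_def)
next
  fix z assume "z \<in> f x +o K"
  moreover have "x \<in> x +o K" using K(1) by (force simp: elt_set_plus_def)
  ultimately show "z \<in> induced_map f K (x +o K)" by (auto simp: induced_map_def)
qed

definition trivial_on_quotient ::
  "('g, 'm) monoid_scheme \<Rightarrow> ('g \<Rightarrow> 'a::ab_group_add \<Rightarrow> 'a) \<Rightarrow> 'a set \<Rightarrow> bool" where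
  "trivial_on_quotient G \<alpha> K \<longleftrightarrow>
     (\<forall>g\<in>carrier G. \<forall>C\<in>cosets K. induced_map (\<alpha> g) K C = C)"


section \<open>Polycyclic groups and \<open>GL(n, \<int>)\<close>\<close>

definition polycyclic_group :: "('g, 'm) monoid_scheme \<Rightarrow> bool" where
  "polycyclic_group G \<longleftrightarrow>
     group G \<and>
     (\<exists>(H :: nat \<Rightarrow> 'g set) n.
        H 0 = {\<one>\<^bsub>G\<^esub>} \<and> H n = carrier G \<and>
        (\<forall>i\<le>n. subgroup (H i) G) \<and>
        (\<forall>i<n. H i \<lhd> G\<lparr>carrier := H (Suc i)\<rparr> \<and>
               cyclic_group (G\<lparr>carrier := H (Suc i)\<rparr> Mod H i)))"

definition GLZ :: "(int ^ 'n ^ 'n) monoid" where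
  "GLZ = \<lparr>carrier = {A. invertible A}, mult = (**), one = mat 1\<rparr>"

lemma group_GLZ: "group (GLZ :: (int ^ 'n ^ 'n) monoid)"
proof (rule groupI)
  show "x \<otimes>\<^bsub>GLZ\<^esub> y \<in> carrier GLZ" if "x \<in> carrier GLZ" "y \<in> carrier GLZ"
    for x y :: "int ^ 'n ^ 'n"
    using that by (auto simp: GLZ_def intro: invertible_mult)
  show "\<exists>y\<in>carrier GLZ. y \<otimes>\<^bsub>GLZ\<^esub> x = \<one>\<^bsub>GLZ\<^esub>" if "x \<in> carrier GLZ"
    for x :: "int ^ 'n ^ 'n"
    using that by (auto simp: GLZ_def invertible_def)
qed (auto simp: GLZ_def matrix_mul_assoc invertible_def intro: exI[of _ "mat 1"])


section \<open>The torus \<open>\<real>\<^sup>n / \<int>\<^sup>n\<close>\<close>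

quotient_type (overloaded) 'n torus =
  "real ^ 'n::finite" / "\<lambda>x y. \<forall>i. x $ i - y $ i \<in> \<int>"
proof (rule equivpI)
  show "reflp (\<lambda>(x::real^'n) y. \<forall>i. x $ i - y $ i \<in> \<int>)"
    by (auto simp: reflp_def)
  show "symp (\<lambda>(x::real^'n) y. \<forall>i. x $ i - y $ i \<in> \<int>)"
    unfolding symp_def by (metis Ints_minus minus_diff_eq)
  show "transp (\<lambda>(x::real^'n) y. \<forall>i. x $ i - y $ i \<in> \<int>)"
    unfolding transp_def
  proof (intro allI impI)
    fix x y z :: "real^'n" and i
    assume "\<forall>i. x $ i - y $ i \<in> \<int>" "\<forall>i. y $ i - z $ i \<in> \<int>"
    then have "(x $ i - y $ i) + (y $ i - z $ i) \<in> \<int>" by (intro Ints_add) auto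
    then show "x $ i - z $ i \<in> \<int>" by simp
  qed
qed

lemma plus_respects_lattice:
  fixes x x' y y' :: "real ^ 'n"
  assumes "\<forall>i. x $ i - x' $ i \<in> \<int>" "\<forall>i. y $ i - y' $ i \<in> \<int>"
  shows "(x + y) $ i - (x' + y') $ i \<in> \<int>"
proof -
  have "(x $ i - x' $ i) + (y $ i - y' $ i) \<in> \<int>" using assms by (intro Ints_add) auto
  then show ?thesis by (simp add: algebra_simps)
qed

lemma uminus_respects_lattice:
  fixes x x' :: "real ^ 'n"
  assumes "\<forall>i. x $ i - x' $ i \<in> \<int>"
  shows "(- x) $ i - (- x') $ i \<in> \<int>"
proof -
  have "- (x $ i - x' $ i) \<in> \<int>" using assms by (intro Ints_minus) auto
  then show ?thesis by simp
qed

instantiation torus :: (finite) ab_group_add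
begin

lift_definition zero_torus :: "'a torus" is "0" .

lift_definition plus_torus :: "'a torus \<Rightarrow> 'a torus \<Rightarrow> 'a torus" is "(+)"
  using plus_respects_lattice by blast

lift_definition uminus_torus :: "'a torus \<Rightarrow> 'a torus" is "uminus"
  using uminus_respects_lattice by blast

definition minus_torus :: "'a torus \<Rightarrow> 'a torus \<Rightarrow> 'a torus" where
  "minus_torus x y = x + - y"

instance
proof
  fix a b c :: "'a torus"
  show "a + b + c = a + (b + c)" by transfer (simp add: algebra_simps)
  show "a + b = b + a" by transfer (simp add: algebra_simps)
  show "0 + a = a" by transfer simp
  show "- a + a = 0" by transfer simp
  show "a - b = a + - b" by (rule minus_torus_def)
qed

end

instantiation torus :: (finite) topological_space
begin

text \<open>The quotient topology.\<close>

definition open_torus :: "'a torus set \<Rightarrow> bool" where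
  "open_torus U \<longleftrightarrow> open (abs_torus -` U)"

instance
  by standard (auto simp: open_torus_def vimage_Union)

end

lemma abs_torus_add: "abs_torus (x + y) = abs_torus x + abs_torus y"
  by (simp add: plus_torus.abs_eq)

lemma abs_torus_minus: "abs_torus (- x) = - abs_torus x"
  by (simp add: uminus_torus.abs_eq)

lemma abs_torus_eq_iff: "abs_torus x = abs_torus y \<longleftrightarrow> (\<forall>i. x $ i - y $ i \<in> \<int>)"
  by (rule torus.abs_eq_iff)

lemma abs_torus_surj: "\<exists>x. t = abs_torus x"
  by (induct t rule: torus.abs_induct) blast

lemma continuous_abs_torus: "continuous_on S abs_torus"
  by (rule continuous_on_subset[of UNIV])
    (auto simp: continuous_on_open_vimage open_torus_def)

lemma open_abs_torus_image:
  assumes "open S" shows "open (abs_torus ` S)"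
proof -
  have "abs_torus -` abs_torus ` S =
      (\<Union>v\<in>{v. \<forall>i. v $ i \<in> \<int>}. (+) v ` S)" (is "?L = ?R")
  proof (intro equalityI subsetI)
    fix x assume "x \<in> ?L"
    then obtain y where y: "y \<in> S" "abs_torus x = abs_torus y" by auto
    then have "\<forall>i. (x - y) $ i \<in> \<int>" by (simp add: abs_torus_eq_iff)
    moreover have "x = (x - y) + y" by simp
    ultimately show "x \<in> ?R" using y(1) by blast
  next
    fix x assume "x \<in> ?R"
    then obtain v y where "y \<in> S" "x = v + y" "\<forall>i. v $ i \<in> \<int>" by auto
    then have "abs_torus x = abs_torus y" by (simp add: abs_torus_eq_iff)
    then show "x \<in> ?L" using \<open>y \<in> S\<close> by auto
  qed
  then show ?thesis
    by (auto simp: open_torus_def intro!: open_UN open_translation assms)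
qed

instance torus :: (finite) topological_ab_group_add
proof
  fix a b :: "'a torus"
  show "filterlim (\<lambda>x. fst x + snd x) (nhds (a + b)) (nhds a \<times>\<^sub>F nhds b)"
    unfolding filterlim_def le_filter_def eventually_filtermap
  proof (intro allI impI)
    fix P assume "eventually P (nhds (a + b))"
    then obtain U where U: "open U" "a + b \<in> U" "\<forall>x\<in>U. P x"
      by (auto simp: eventually_nhds)
    obtain x y where xy: "a = abs_torus x" "b = abs_torus y"
      using abs_torus_surj by metis
    have "open (abs_torus -` U)" "x + y \<in> abs_torus -` U"
      using U xy by (auto simp: open_torus_def abs_torus_add)
    then have "eventually (\<lambda>z. z \<in> abs_torus -` U) (nhds (x + y))"
      by (auto simp: eventually_nhds)
    moreover have "filterlim (\<lambda>z. fst z + snd z) (nhds (x + y)) (nhds x \<times>\<^sub>F nhds y)"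
      by (rule tendsto_add_Pair)
    ultimately have "eventually (\<lambda>z. fst z + snd z \<in> abs_torus -` U) (nhds x \<times>\<^sub>F nhds y)"
      by (rule filterlim_iff[THEN iffD1, rule_format, rotated])
    then obtain A B where AB: "eventually A (nhds x)" "eventually B (nhds y)"
      "\<And>u v. A u \<Longrightarrow> B v \<Longrightarrow> u + v \<in> abs_torus -` U"
      by (auto simp: eventually_prod_filter)
    obtain A' B' where AB': "open A'" "x \<in> A'" "\<forall>u\<in>A'. A u" "open B'" "y \<in> B'" "\<forall>u\<in>B'. B u"
      using AB(1,2) by (auto simp: eventually_nhds)
    have "eventually (\<lambda>z. z \<in> abs_torus ` A') (nhds a)"
      "eventually (\<lambda>z. z \<in> abs_torus ` B') (nhds b)"
      using AB'(2,5) open_abs_torus_image[OF AB'(1)] open_abs_torus_image[OF AB'(4)]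
      unfolding eventually_nhds xy by blast+
    moreover have "P (s + t)" if "s \<in> abs_torus ` A'" "t \<in> abs_torus ` B'" for s t
      using that U(3) AB(3) AB'(3,6) by (auto simp flip: abs_torus_add)
    ultimately show "eventually (\<lambda>x. P (fst x + snd x)) (nhds a \<times>\<^sub>F nhds b)"
      unfolding eventually_prod_filter
      by (intro exI[of _ "\<lambda>z. z \<in> abs_torus ` A'"] exI[of _ "\<lambda>z. z \<in> abs_torus ` B'"]) auto
  qed
  show "(uminus \<longlongrightarrow> - a) (nhds a)"
    unfolding filterlim_def le_filter_def eventually_filtermap
  proof (intro allI impI)
    fix P assume "eventually P (nhds (- a))"
    then obtain U where U: "open U" "- a \<in> U" "\<forall>x\<in>U. P x"
      by (auto simp: eventually_nhds)
    have "abs_torus -` (uminus -` U) = uminus -` (abs_torus -` U)"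
      by (auto simp: abs_torus_minus)
    moreover have "open (uminus -` (abs_torus -` U))"
      using U(1) by (intro open_vimage[OF _ continuous_on_minus[OF continuous_on_id]])
        (simp add: open_torus_def)
    ultimately have "open (uminus -` U)" by (simp add: open_torus_def)
    then show "eventually (\<lambda>x. P (- x)) (nhds a)"
      using U(2,3) by (auto simp: eventually_nhds)
  qed
qed

instance torus :: (finite) second_countable_topology
proof
  obtain B :: "(real^'a) set set" where B: "countable B" "topological_basis B"
    using ex_countable_basis by auto
  have "topological_basis ((`) abs_torus ` B)"
  proof (rule topological_basisI)
    show "open S" if "S \<in> (`) abs_torus ` B" for S :: "'a torus set"
      using that B(2) by (auto intro!: open_abs_torus_image topological_basis_open)
    fix U and t :: "'a torus" assume U: "open U" "t \<in> U"
    obtain x where x: "t = abs_torus x" using abs_torus_surj by metis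
    obtain S where "S \<in> B" "x \<in> S" "S \<subseteq> abs_torus -` U"
      using topological_basisE[OF B(2), of "abs_torus -` U" x] U x
      by (auto simp: open_torus_def)
    then show "\<exists>S\<in>(`) abs_torus ` B. t \<in> S \<and> S \<subseteq> U" using x by auto
  qed
  then show "\<exists>B::'a torus set set. countable B \<and> open = generate_topology B"
    using B(1) by (auto intro!: exI[of _ "(`) abs_torus ` B"] topological_basis_imp_subbasis)
qed

lemma integer_matrix_respects_lattice:
  fixes A :: "int ^ 'n ^ 'n" and x y :: "real ^ 'n"
  assumes "\<forall>i. x $ i - y $ i \<in> \<int>"
  shows "(map_matrix real_of_int A *v x) $ i - (map_matrix real_of_int A *v y) $ i \<in> \<int>"
proof -
  have "(map_matrix real_of_int A *v x) $ i - (map_matrix real_of_int A *v y) $ i =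
      (\<Sum>j\<in>UNIV. real_of_int (A $ i $ j) * (x $ j - y $ j))"
    by (simp add: matrix_vector_mult_def sum_subtractf right_diff_distrib)
  then show ?thesis using assms by (auto intro!: Ints_mult)
qed

lift_definition natural_action :: "int ^ 'n ^ 'n \<Rightarrow> 'n torus \<Rightarrow> 'n torus" is
  "\<lambda>A x. map_matrix real_of_int A *v x"
  using integer_matrix_respects_lattice by blast

section \<open>Existence and uniqueness of Haar measure on the torus\<close>

lemma normalized_haar_unique:
  fixes \<mu> \<nu> :: "'a::{topological_ab_group_add, second_countable_topology} measure"
  assumes \<mu>: "normalized_haar \<mu>" and \<nu>: "normalized_haar \<nu>"
  shows "\<mu> = \<nu>"
proof (rule measure_eqI)
  show "sets \<mu> = sets \<nu>" using assms by (simp add: normalized_haar_def)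
  have sets[measurable_cong]: "sets \<mu> = sets borel" "sets \<nu> = sets borel"
    using assms by (auto simp: normalized_haar_def)
  have space: "space \<mu> = UNIV" "space \<nu> = UNIV"
    using sets[THEN sets_eq_imp_space_eq] by auto
  interpret M: finite_measure \<mu>
    by standard (use \<mu> space in \<open>auto simp: normalized_haar_def\<close>)
  interpret N: finite_measure \<nu>
    by standard (use \<nu> space in \<open>auto simp: normalized_haar_def\<close>)
  interpret MN: pair_sigma_finite \<mu> \<nu> ..
  have cont: "continuous_on UNIV (\<lambda>z::'a \<times> 'a. fst z + snd z)"
    unfolding continuous_on_def
    by (intro ballI tendsto_add tendsto_fst tendsto_snd tendsto_ident_at)
  have meas: "(\<lambda>z::'a \<times> 'a. fst z + snd z) \<in> borel_measurable borel"
    by (rule borel_measurable_continuous_onI[OF cont])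
  have meas2[measurable]: "(\<lambda>z. fst z + snd z) \<in> measurable (\<mu> \<Otimes>\<^sub>M \<nu>) borel"
    using meas by (simp add: sets borel_prod[symmetric] cong: measurable_cong_sets sets_pair_measure_cong)
  have tr: "emeasure m {y. x + y \<in> E} = emeasure m E"
    if "normalized_haar m" "E \<in> sets borel" for m :: "'a measure" and x E
  proof -
    have sm: "sets m = sets borel" and d: "distr m borel ((+) x) = m"
      using that by (auto simp: normalized_haar_def)
    have "continuous_on UNIV ((+) x)"
      unfolding continuous_on_def by (auto intro!: tendsto_add tendsto_ident_at)
    then have "(+) x \<in> measurable m borel"
      using borel_measurable_continuous_onI by (simp add: sm cong: measurable_cong_sets)
    then have "emeasure (distr m borel ((+) x)) E = emeasure m ((+) x -` E \<inter> space m)"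
      using that by (intro emeasure_distr) auto
    then show ?thesis using d sets_eq_imp_space_eq[OF sm] by (simp add: vimage_def)
  qed
  fix E assume "E \<in> sets \<mu>"
  then have E[measurable]: "E \<in> sets borel" using sets by simp
  let ?f = "\<lambda>x y. indicator E (x + y) :: ennreal"
  have fm: "(\<lambda>z. ?f (fst z) (snd z)) \<in> borel_measurable (\<mu> \<Otimes>\<^sub>M \<nu>)"
    by measurable
  have slice: "{y. x + y \<in> E} \<in> sets borel" for x
  proof -
    have "continuous_on UNIV ((+) x)"
      unfolding continuous_on_def by (auto intro!: tendsto_add tendsto_ident_at)
    from measurable_sets[OF borel_measurable_continuous_onI[OF this] E]
    show ?thesis by (simp add: vimage_def)
  qed
  have "(\<integral>\<^sup>+y. ?f x y \<partial>\<nu>) = emeasure \<nu> E" for x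
  proof -
    have "(\<integral>\<^sup>+y. ?f x y \<partial>\<nu>) = (\<integral>\<^sup>+y. indicator {y. x + y \<in> E} y \<partial>\<nu>)"
      by (intro nn_integral_cong) (auto simp: indicator_def)
    also have "\<dots> = emeasure \<nu> E"
      using slice[of x] tr[OF \<nu> E, of x] by (simp add: sets)
    finally show ?thesis .
  qed
  moreover have "(\<integral>\<^sup>+x. ?f x y \<partial>\<mu>) = emeasure \<mu> E" for y
  proof -
    have "(\<integral>\<^sup>+x. ?f x y \<partial>\<mu>) = (\<integral>\<^sup>+x. indicator {x. y + x \<in> E} x \<partial>\<mu>)"
      by (intro nn_integral_cong) (auto simp: indicator_def add.commute)
    also have "\<dots> = emeasure \<mu> E"
      using slice[of y] tr[OF \<mu> E, of y] by (simp add: sets)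
    finally show ?thesis .
  qed
  moreover have "(\<integral>\<^sup>+y. (\<integral>\<^sup>+x. ?f x y \<partial>\<mu>) \<partial>\<nu>) = (\<integral>\<^sup>+x. (\<integral>\<^sup>+y. ?f x y \<partial>\<nu>) \<partial>\<mu>)"
    using MN.Fubini[OF fm] by simp
  ultimately show "emeasure \<mu> E = emeasure \<nu> E"
    using \<mu> \<nu> space by (simp add: normalized_haar_def)
qed

definition unit_cube :: "(real ^ 'n) set" where
  "unit_cube = {x. \<forall>i. 0 \<le> x $ i \<and> x $ i < 1}"

lemma unit_cube_measurable [measurable]: "(unit_cube :: (real ^ 'n) set) \<in> sets borel"
proof -
  have "unit_cube = (\<Inter>i. {x::real^'n. 0 \<le> x $ i} \<inter> {x. x $ i < 1})"
    by (auto simp: unit_cube_def)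
  moreover have "{x::real^'n. 0 \<le> x $ i} \<inter> {x. x $ i < 1} \<in> sets borel" for i
    by (intro sets.Int borel_closed borel_open closed_Collect_le open_Collect_less
        continuous_intros)
  then have "(\<Inter>i. {x::real^'n. 0 \<le> x $ i} \<inter> {x. x $ i < 1}) \<in> sets borel"
    by (intro sets.finite_INT) auto
  ultimately show ?thesis by simp
qed

lemma emeasure_unit_cube: "emeasure lborel (unit_cube :: (real^'n) set) = 1"
proof (rule antisym)
  have one: "(\<Prod>b\<in>Basis. ((\<chi> i. 1) - 0 :: real^'n) \<bullet> b) = 1"
    by (rule prod.neutral) (auto simp: Basis_vec_def inner_axis)
  have le: "\<And>b. b \<in> Basis \<Longrightarrow> (0::real^'n) \<bullet> b \<le> (\<chi> i. 1) \<bullet> b"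
    by (auto simp: Basis_vec_def inner_axis)
  have "emeasure lborel (unit_cube :: (real^'n) set) \<le> emeasure lborel (cbox (0::real^'n) (\<chi> i. 1))"
    by (intro emeasure_mono) (auto simp: unit_cube_def mem_box_cart less_imp_le)
  also have "\<dots> = 1" using le one by (subst emeasure_lborel_cbox) auto
  finally show "emeasure lborel (unit_cube :: (real^'n) set) \<le> 1" .
  have "1 = emeasure lborel (box (0::real^'n) (\<chi> i. 1))"
    using le one by (subst emeasure_lborel_box) auto
  also have "\<dots> \<le> emeasure lborel (unit_cube :: (real^'n) set)"
    by (intro emeasure_mono) (auto simp: unit_cube_def mem_box_cart less_imp_le)
  finally show "1 \<le> emeasure lborel (unit_cube :: (real^'n) set)" .
qed

lemma countable_lattice: "countable {v :: real^'n. \<forall>i. v $ i \<in> \<int>}"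
proof (rule countable_subset)
  show "{v :: real^'n. \<forall>i. v $ i \<in> \<int>} \<subseteq> vec_lambda ` (PiE UNIV (\<lambda>_. \<int>))"
  proof
    fix v :: "real^'n" assume "v \<in> {v. \<forall>i. v $ i \<in> \<int>}"
    then have "vec_nth v \<in> PiE UNIV (\<lambda>_. \<int>)" by auto
    then show "v \<in> vec_lambda ` (PiE UNIV (\<lambda>_. \<int>))"
      by (rule image_eqI[rotated]) (simp add: vec_nth_inverse)
  qed
  have "countable (\<int> :: real set)" by (simp add: Ints_def)
  then show "countable (vec_lambda ` (PiE UNIV (\<lambda>_::'n. \<int>::real set)))"
    by (intro countable_image countable_PiE) auto
qed

lemma unit_cube_tiles:
  "\<exists>!v. (\<forall>i. v $ i \<in> \<int>) \<and> (x::real^'n) - v \<in> unit_cube"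
proof (rule ex1I[of _ "\<chi> i. of_int \<lfloor>x $ i\<rfloor>"])
  show "(\<forall>i. (\<chi> i. of_int \<lfloor>x $ i\<rfloor> :: real^'n) $ i \<in> \<int>) \<and>
      x - (\<chi> i. of_int \<lfloor>x $ i\<rfloor>) \<in> unit_cube"
    by (auto simp: unit_cube_def) linarith
  fix v :: "real^'n" assume v: "(\<forall>i. v $ i \<in> \<int>) \<and> x - v \<in> unit_cube"
  show "v = (\<chi> i. of_int \<lfloor>x $ i\<rfloor>)"
  proof (subst vec_eq_iff, intro allI)
    fix i
    obtain k where "v $ i = of_int k" using v by (auto elim!: Ints_cases)
    moreover have "0 \<le> x $ i - v $ i" "x $ i - v $ i < 1"
      using v by (auto simp: unit_cube_def)
    ultimately have "\<lfloor>x $ i\<rfloor> = k" by (intro floor_unique) auto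
    then show "v $ i = (\<chi> i. of_int \<lfloor>x $ i\<rfloor> :: real^'n) $ i"
      using \<open>v $ i = of_int k\<close> by simp
  qed
qed

lemma lborel_translate:
  assumes "A \<in> sets borel"
  shows "emeasure lborel {x :: 'a::euclidean_space. c + x \<in> A} = emeasure lborel A"
proof -
  have "emeasure lborel A = emeasure (distr lborel borel ((+) c)) A"
    by (simp add: lborel_distr_plus)
  also have "\<dots> = emeasure lborel ((+) c -` A \<inter> space lborel)"
    using assms by (intro emeasure_distr) auto
  finally show ?thesis by (simp add: vimage_def)
qed

lemma emeasure_tiles:
  fixes A D L :: "'a::euclidean_space set"
  assumes "countable L" and tiles: "\<And>x. \<exists>!v. v \<in> L \<and> x - v \<in> D"
    and "\<And>v. A \<inter> {x. x - v \<in> D} \<in> sets lborel"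
  shows "emeasure lborel A = (\<integral>\<^sup>+v. emeasure lborel (A \<inter> {x. x - v \<in> D}) \<partial>count_space L)"
proof -
  have "A = (\<Union>v\<in>L. A \<inter> {x. x - v \<in> D})"
  proof (intro equalityI subsetI)
    fix x assume "x \<in> A"
    moreover obtain v where "v \<in> L" "x - v \<in> D" using tiles by metis
    ultimately show "x \<in> (\<Union>v\<in>L. A \<inter> {x. x - v \<in> D})" by auto
  qed auto
  moreover have "disjoint_family_on (\<lambda>v. A \<inter> {x. x - v \<in> D}) L"
    unfolding disjoint_family_on_def
  proof (intro ballI impI)
    fix v w assume "v \<in> L" "w \<in> L" "v \<noteq> w"
    then have "\<not> (x - v \<in> D \<and> x - w \<in> D)" for x using tiles[of x] by metis
    then show "(A \<inter> {x. x - v \<in> D}) \<inter> (A \<inter> {x. x - w \<in> D}) = {}" by auto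
  qed
  ultimately show ?thesis
    using emeasure_UN_countable[of L "\<lambda>v. A \<inter> {x. x - v \<in> D}" lborel] assms(1,3) by auto
qed

lemma fundamental_domain_translate:
  fixes F :: "(real^'n) set"
  assumes F[measurable]: "F \<in> sets borel"
    and inv: "\<And>v x. \<forall>i. v $ i \<in> \<int> \<Longrightarrow> v + x \<in> F \<longleftrightarrow> x \<in> F"
  shows "emeasure lborel {x\<in>F. s + x \<in> unit_cube} = emeasure lborel (F \<inter> unit_cube)"
proof -
  let ?L = "{v :: real^'n. \<forall>i. v $ i \<in> \<int>}"
  let ?C = "unit_cube :: (real^'n) set"
  let ?D = "{x. s + x \<in> ?C}"
  have [measurable]: "?D \<in> sets borel"
    by measurable
  have LD: "\<exists>!v. v \<in> ?L \<and> x - v \<in> ?D" for x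
    using unit_cube_tiles[of "s + x"] by (simp add: algebra_simps)
  have LC: "\<exists>!v. v \<in> ?L \<and> x - v \<in> ?C" for x
    using unit_cube_tiles[of x] by simp
  let ?X = "\<lambda>v. F \<inter> ?C \<inter> {x. x - v \<in> ?D}"
  let ?Y = "\<lambda>v. F \<inter> ?D \<inter> {x. x - v \<in> ?C}"
  have [measurable]: "?X v \<in> sets borel" "?Y v \<in> sets borel" for v
    by measurable
  have "emeasure lborel (F \<inter> ?C) = (\<integral>\<^sup>+v. emeasure lborel (?X v) \<partial>count_space ?L)"
    by (rule emeasure_tiles[OF countable_lattice LD]) simp
  also have "\<dots> = (\<integral>\<^sup>+v. emeasure lborel (?Y (- v)) \<partial>count_space ?L)"
  proof (rule nn_integral_cong)
    fix v assume "v \<in> space (count_space ?L)"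
    then have "v \<in> ?L" by simp
    have "?Y (- v) = {x. v + x \<in> ?X v}"
      using inv[of v] \<open>v \<in> ?L\<close> by (auto simp: algebra_simps)
    then show "emeasure lborel (?X v) = emeasure lborel (?Y (- v))"
      using lborel_translate[of "?X v" v] by simp
  qed
  also have "\<dots> = (\<integral>\<^sup>+v. emeasure lborel (?Y v) \<partial>count_space ?L)"
  proof (rule nn_integral_bij_count_space)
    show "bij_betw uminus ?L ?L"
      by (rule bij_betw_byWitness[of _ uminus]) auto
  qed
  also have "\<dots> = emeasure lborel (F \<inter> ?D)"
    by (rule emeasure_tiles[OF countable_lattice LC, symmetric]) simp
  finally show ?thesis by (simp add: Int_def)
qed

lemma abs_torus_measurable [measurable]: "abs_torus \<in> borel_measurable borel"
  by (rule borel_measurable_continuous_onI[OF continuous_abs_torus])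

lemma normalized_haar_torus:
  "normalized_haar (distr (restrict_space lborel unit_cube) borel abs_torus :: 'n::finite torus measure)"
    (is "normalized_haar ?\<mu>")
proof -
  have m: "abs_torus \<in> measurable (restrict_space lborel (unit_cube :: (real^'n) set)) borel"
    by (intro measurable_restrict_space1) simp
  have em: "emeasure ?\<mu> E = emeasure lborel (abs_torus -` E \<inter> unit_cube)"
    if "E \<in> sets borel" for E :: "'n torus set"
    using that m by (simp add: emeasure_distr emeasure_restrict_space space_restrict_space)
  have "distr ?\<mu> borel ((+) t) = ?\<mu>" for t
  proof (rule measure_eqI)
    fix E :: "'n torus set" assume "E \<in> sets (distr ?\<mu> borel ((+) t))"
    then have E: "E \<in> sets borel" by simp
    obtain s where s: "t = abs_torus s" using abs_torus_surj by metis
    have "continuous_on UNIV ((+) t)"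
      unfolding continuous_on_def by (auto intro!: tendsto_add tendsto_ident_at)
    then have tm: "(+) t \<in> measurable borel borel" by (rule borel_measurable_continuous_onI)
    let ?F = "abs_torus -` E"
    have F: "?F \<in> sets borel" using measurable_sets[OF abs_torus_measurable E] by simp
    have per: "v + x \<in> ?F \<longleftrightarrow> x \<in> ?F" if "\<forall>i. v $ i \<in> \<int>" for v x :: "real^'n"
    proof -
      have "abs_torus (v + x) = abs_torus x" using that by (simp add: abs_torus_eq_iff)
      then show ?thesis by simp
    qed
    have "emeasure (distr ?\<mu> borel ((+) t)) E = emeasure ?\<mu> ((+) t -` E)"
      using tm E by (subst emeasure_distr) auto
    also have "\<dots> = emeasure lborel (abs_torus -` ((+) t -` E) \<inter> unit_cube)"
      using measurable_sets[OF tm E] by (intro em) simp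
    also have "abs_torus -` ((+) t -` E) \<inter> unit_cube = {x. s + x \<in> {x \<in> ?F. (- s) + x \<in> unit_cube}}"
      by (auto simp: s abs_torus_add)
    also have "emeasure lborel \<dots> = emeasure lborel {x \<in> ?F. (- s) + x \<in> unit_cube}"
    proof (rule lborel_translate)
      have "{x. - s + x \<in> unit_cube} \<in> sets borel" by measurable
      then have "?F \<inter> {x. - s + x \<in> unit_cube} \<in> sets borel" using F by blast
      then show "{x \<in> ?F. - s + x \<in> unit_cube} \<in> sets borel" by (simp add: Int_def)
    qed
    also have "\<dots> = emeasure lborel (?F \<inter> unit_cube)"
      by (rule fundamental_domain_translate[OF F per])
    also have "\<dots> = emeasure ?\<mu> E" using em[OF E] by simp
    finally show "emeasure (distr ?\<mu> borel ((+) t)) E = emeasure ?\<mu> E" .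
  qed simp
  then show ?thesis
    using em[of UNIV] by (simp add: normalized_haar_def emeasure_unit_cube)
qed

lemma normalized_haar_ex1: "\<exists>!\<mu> :: 'n::finite torus measure. normalized_haar \<mu>"
  using normalized_haar_torus normalized_haar_unique by blast

lemma haar_torus:
  "(haar :: 'n::finite torus measure) = distr (restrict_space lborel unit_cube) borel abs_torus"
  unfolding haar_def by (rule the1_equality[OF normalized_haar_ex1 normalized_haar_torus])

end

(* The group consists of the matrices with blocks (C^n, v; 0, 1), where C = (2, 1; 1, 1) is
   hyperbolic and v ranges over Z^2. It is polycyclic along 1 < Z < Z^2 < Z^2 : Z, and it fixes the
   third coordinate, which therefore factors through to a circle with trivial action. If all
   translates of a point are close to 0, then the shears by multiples of (1, 0) keep the multiples
   of its third coordinate bounded, so that coordinate vanishes, and the hyperbolicity of C then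
   kills the other two. *)
theory Submission
  imports Defs
begin

section \<open>The natural action on the torus\<close>

text \<open>The circle with trivial action must be a quotient that does not split off. A circle of
  fixed points inside the torus would rule out expansiveness, and the powers of C alone produce one,
  since they fix every point (0, 0, t). The translation parts v move these points: they add
  multiples of the third coordinate to the first two. The obstacle to expansiveness is that
  closeness to 0 in the torus says nothing about the size of a given lift, so a linear estimate in
  R^3 does not apply to a whole orbit at once. The orbit is therefore lifted one matrix at a time,
  with matrices from a short list: one shear, C and its inverse. These enlarge the largest
  coordinate by a factor of at most 3, so the image of a lift close to 0 cannot differ by a nonzero
  integer vector from the lift close to 0 of the next orbit point. Iterating such steps yields the
  estimates for large group elements.\<close>

lemma natural_action_abs_torus:
  "natural_action A (abs_torus x) = abs_torus (map_matrix real_of_int A *v x)"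
  by (rule natural_action.abs_eq)

lemma map_matrix_of_int_mult:
  fixes A B :: "int ^ 'n ^ 'n"
  shows "map_matrix real_of_int (A ** B) = map_matrix real_of_int A ** map_matrix real_of_int B"
  by (simp add: vec_eq_iff matrix_matrix_mult_def map_matrix_def)

lemma map_matrix_of_int_one: "map_matrix real_of_int (mat 1 :: int ^ 'n ^ 'n) = mat 1"
  by (simp add: vec_eq_iff mat_def map_matrix_def)

lemma natural_action_mult: "natural_action (A ** B) = natural_action A \<circ> natural_action B"
proof
  fix t :: "'a torus"
  obtain x where "t = abs_torus x" using abs_torus_surj by blast
  then show "natural_action (A ** B) t = (natural_action A \<circ> natural_action B) t"
    by (simp add: natural_action_abs_torus map_matrix_of_int_mult matrix_vector_mul_assoc)
qed

lemma natural_action_one: "natural_action (mat 1) = id"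
proof
  fix t :: "'a torus"
  obtain x where "t = abs_torus x" using abs_torus_surj by blast
  then show "natural_action (mat 1) t = id t"
    by (simp add: natural_action_abs_torus map_matrix_of_int_one)
qed

lemma GLZ_simps: "x \<otimes>\<^bsub>GLZ\<^esub> y = x ** y" "\<one>\<^bsub>GLZ\<^esub> = mat 1"
  by (simp_all add: GLZ_def)

lemma natural_action_inv:
  assumes "A \<in> carrier GLZ"
  shows "natural_action A (natural_action (inv\<^bsub>GLZ\<^esub> A) t) = t"
proof -
  have "A ** inv\<^bsub>GLZ\<^esub> A = mat 1"
    using group.r_inv[OF group_GLZ assms] by (simp add: GLZ_simps)
  then have "natural_action A \<circ> natural_action (inv\<^bsub>GLZ\<^esub> A) = id"
    by (simp add: natural_action_one flip: natural_action_mult)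
  then show ?thesis by (simp add: fun_eq_iff)
qed

lemma natural_action_add: "natural_action A (s + t) = natural_action A s + natural_action A t"
proof -
  obtain x y where "s = abs_torus x" "t = abs_torus y" using abs_torus_surj by metis
  then show ?thesis
    by (simp add: natural_action_abs_torus matrix_vector_right_distrib flip: abs_torus_add)
qed

text \<open>Openness in the quotient topology is tested on preimages in R^n, where the action is
  linear.\<close>

lemma continuous_natural_action: "continuous_on UNIV (natural_action A)"
  unfolding continuous_on_open_vimage[OF open_UNIV]
proof (intro allI impI)
  fix U :: "'a torus set" assume U: "open U"
  have "abs_torus -` (natural_action A -` U) =
      (\<lambda>x. map_matrix real_of_int A *v x) -` (abs_torus -` U)"
    by (auto simp: natural_action_abs_torus)
  moreover have "open \<dots>"
  proof (rule open_vimage)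
    show "open (abs_torus -` U)" using U by (simp add: open_torus_def)
    show "continuous_on UNIV (\<lambda>x. map_matrix real_of_int A *v x)"
      by (intro linear_continuous_on matrix_vector_mul_bounded_linear)
  qed
  ultimately show "open (natural_action A -` U \<inter> UNIV)" by (simp add: open_torus_def)
qed

section \<open>Compactness, connectedness and metrizability of the torus\<close>

lemma compact_torus: "compact (UNIV :: 'n::finite torus set)"
proof -
  have "(UNIV :: 'n torus set) = abs_torus ` cbox 0 (\<chi> i. 1)"
  proof (intro equalityI subsetI)
    fix t :: "'n torus"
    obtain x where x: "t = abs_torus x" using abs_torus_surj by blast
    have "abs_torus x = abs_torus (\<chi> i. frac (x $ i))"
      by (simp add: abs_torus_eq_iff frac_def)
    moreover have "(\<chi> i. frac (x $ i)) \<in> cbox 0 (\<chi> i. 1)"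
      by (simp add: mem_box_cart frac_ge_0 frac_lt_1 less_imp_le)
    ultimately show "t \<in> abs_torus ` cbox 0 (\<chi> i. 1)" using x by blast
  qed simp
  moreover have "compact (abs_torus ` cbox 0 (\<chi> i. 1) :: 'n torus set)"
    by (intro compact_continuous_image continuous_abs_torus compact_cbox)
  ultimately show ?thesis by simp
qed

lemma connected_torus: "connected (UNIV :: 'n::finite torus set)"
proof -
  have "(UNIV :: 'n torus set) = range abs_torus" using abs_torus_surj by blast
  moreover have "connected (range abs_torus :: 'n torus set)"
    by (intro connected_continuous_image continuous_abs_torus connected_UNIV)
  ultimately show ?thesis by simp
qed

lemma circles_respect_lattice:
  fixes x y :: "real ^ 'n"
  assumes "\<forall>i. x $ i - y $ i \<in> \<int>"
  shows "(\<chi> i. cis (2 * pi * x $ i)) = (\<chi> i. cis (2 * pi * y $ i))"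
proof -
  have "cis (2 * pi * x $ i) = cis (2 * pi * y $ i)" for i
  proof -
    have "cis (2 * pi * (x $ i - y $ i)) = 1" using assms by (intro cis_multiple_2pi) auto
    moreover have "cis (2 * pi * x $ i) = cis (2 * pi * (x $ i - y $ i)) * cis (2 * pi * y $ i)"
      by (simp add: cis_mult algebra_simps)
    ultimately show ?thesis by simp
  qed
  then show ?thesis by simp
qed

text \<open>The torus carries only its quotient topology; this map into a metric space serves to
  make it metrizable.\<close>

lift_definition torus_to_circles :: "'n::finite torus \<Rightarrow> complex ^ 'n" is
  "\<lambda>x. \<chi> i. cis (2 * pi * x $ i)"
  by (rule circles_respect_lattice) blast

lemma inj_torus_to_circles: "inj torus_to_circles"
proof (rule injI)
  fix s t :: "'n::finite torus" assume eq: "torus_to_circles s = torus_to_circles t"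
  obtain x y where xy: "s = abs_torus x" "t = abs_torus y" using abs_torus_surj by metis
  have "x $ i - y $ i \<in> \<int>" for i
  proof -
    have "cis (2 * pi * x $ i) = cis (2 * pi * y $ i)"
      using eq by (simp add: xy torus_to_circles.abs_eq vec_eq_iff)
    then have "cis (2 * pi * x $ i - 2 * pi * y $ i) = 1"
      by (metis cis_divide cis_neq_zero divide_self)
    then obtain n :: int where "2 * pi * x $ i - 2 * pi * y $ i = of_int n * (2 * pi)"
      by (auto simp: complex_eq_iff cos_one_2pi_int)
    then have "(2 * pi) * (x $ i - y $ i) = (2 * pi) * of_int n"
      by (simp add: algebra_simps)
    then have "x $ i - y $ i = of_int n" by simp
    then show ?thesis by simp
  qed
  then show "s = t" by (simp add: xy abs_torus_eq_iff)
qed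

lemma continuous_torus_to_circles: "continuous_on UNIV torus_to_circles"
  unfolding continuous_on_open_vimage[OF open_UNIV]
proof (intro allI impI)
  fix U :: "(complex ^ 'a) set" assume U: "open U"
  have "abs_torus -` (torus_to_circles -` U) = (\<lambda>x. \<chi> i. cis (2 * pi * x $ i)) -` U"
    by (auto simp: torus_to_circles.abs_eq)
  moreover have "open \<dots>"
    using U by (intro open_vimage continuous_intros)
  ultimately show "open (torus_to_circles -` U \<inter> UNIV)" by (simp add: open_torus_def)
qed

text \<open>A continuous injection of a compact space into a Hausdorff space is a homeomorphism onto
  its image, and metrizability passes from the image back to the torus.\<close>

lemma metrizable_torus: "metrizable_space (euclidean :: 'n::finite torus topology)"
proof -
  obtain g where "homeomorphism (UNIV :: 'n torus set) (range torus_to_circles) torus_to_circles g"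
    using homeomorphism_compact[OF compact_torus continuous_torus_to_circles refl inj_torus_to_circles]
    by blast
  then have "(euclidean :: 'n torus topology) homeomorphic_space
      top_of_set (range torus_to_circles :: (complex ^ 'n) set)"
    by (auto simp: homeomorphism_def homeomorphic_space_def homeomorphic_maps_def
        continuous_map_in_subtopology intro!: exI[of _ torus_to_circles] exI[of _ g])
  then show ?thesis
    using homeomorphic_metrizable_space metrizable_space_subtopology metrizable_space_euclidean
    by blast
qed

lemma algebraic_action_natural_action:
  fixes \<Gamma> :: "(int ^ 'n ^ 'n) set"
  assumes \<Gamma>: "subgroup \<Gamma> GLZ"
  shows "algebraic_action (GLZ\<lparr>carrier := \<Gamma>\<rparr>) natural_action"
  unfolding algebraic_action_def
proof (intro conjI ballI)
  show "group (GLZ\<lparr>carrier := \<Gamma>\<rparr>)" by (rule subgroup.subgroup_is_group[OF \<Gamma> group_GLZ])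
  show "compact (UNIV :: 'n torus set)" by (rule compact_torus)
  show "metrizable_space (euclidean :: 'n torus topology)" by (rule metrizable_torus)
  fix A assume "A \<in> carrier (GLZ\<lparr>carrier := \<Gamma>\<rparr>)"
  then have "A \<in> carrier GLZ" using subgroup.subset[OF \<Gamma>] by auto
  then obtain B where "A ** B = mat 1" "B ** A = mat 1" by (auto simp: GLZ_def invertible_def)
  then have "natural_action A \<circ> natural_action B = id" "natural_action B \<circ> natural_action A = id"
    by (simp_all add: natural_action_one flip: natural_action_mult)
  then have "homeomorphism UNIV UNIV (natural_action A) (natural_action B)"
    by (intro homeomorphismI continuous_natural_action) (auto simp: fun_eq_iff)
  then show "continuous_automorphism (natural_action A)"
    by (auto simp: continuous_automorphism_def natural_action_add)
qed (auto simp: GLZ_def natural_action_one natural_action_mult)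


section \<open>Integral affine groups of the plane\<close>

text \<open>The affine map sending w to B w + v, in homogeneous coordinates: matrix multiplication
  is composition of affine maps.\<close>

definition affine_mat :: "int ^ 2 ^ 2 \<Rightarrow> int ^ 2 \<Rightarrow> int ^ 3 ^ 3" where
  "affine_mat B v = vector
     [vector [B $ 1 $ 1, B $ 1 $ 2, v $ 1],
      vector [B $ 2 $ 1, B $ 2 $ 2, v $ 2],
      vector [0, 0, 1]]"

text \<open>For a group S and an S-stable group V this is the semidirect product of V by S. Every
  term of the polycyclic series has this form.\<close>

definition affine_set :: "(int ^ 2 ^ 2) set \<Rightarrow> (int ^ 2) set \<Rightarrow> (int ^ 3 ^ 3) set" where
  "affine_set S V = {affine_mat B v | B v. B \<in> S \<and> v \<in> V}"

lemma affine_mat_mult: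
  "affine_mat B v ** affine_mat C w = affine_mat (B ** C) (B *v w + v)"
  by (simp add: affine_mat_def vec_eq_iff forall_3 matrix_matrix_mult_def matrix_vector_mult_def
      sum_3 sum_2)

lemma affine_mat_one: "affine_mat (mat 1) 0 = mat 1"
  by (simp add: affine_mat_def vec_eq_iff forall_3 mat_def)

lemma affine_mat_action:
  "map_matrix real_of_int (affine_mat B v) *v x = vector
     [of_int (B $ 1 $ 1) * x $ 1 + of_int (B $ 1 $ 2) * x $ 2 + of_int (v $ 1) * x $ 3,
      of_int (B $ 2 $ 1) * x $ 1 + of_int (B $ 2 $ 2) * x $ 2 + of_int (v $ 2) * x $ 3,
      x $ 3]"
  by (simp add: affine_mat_def vec_eq_iff forall_3 matrix_vector_mult_def sum_3 map_matrix_def)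

lemma matrix_vector_mult_minus_right:
  fixes A :: "'a::ring_1 ^ 'n ^ 'm"
  shows "A *v (- v) = - (A *v v)"
  by (simp add: vec_eq_iff matrix_vector_mult_def sum_negf)

lemma affine_mat_in_GLZ:
  assumes "B \<in> carrier GLZ" shows "affine_mat B v \<in> carrier GLZ"
proof -
  obtain C where "B ** C = mat 1" "C ** B = mat 1" using assms by (auto simp: GLZ_def invertible_def)
  \<comment> \<open>The inverse of the affine map sends w to C (w - v).\<close>
  then have "affine_mat B v ** affine_mat C (- (C *v v)) = mat 1"
    "affine_mat C (- (C *v v)) ** affine_mat B v = mat 1"
    by (simp_all add: affine_mat_mult affine_mat_one matrix_vector_mul_assoc
        matrix_vector_mult_minus_right)
  then show ?thesis by (auto simp: GLZ_def invertible_def)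
qed

lemma subgroup_affine_set:
  assumes S: "subgroup S GLZ"
    and V: "0 \<in> V" "\<And>v w. v \<in> V \<Longrightarrow> w \<in> V \<Longrightarrow> v + w \<in> V" "\<And>v. v \<in> V \<Longrightarrow> - v \<in> V"
    and SV: "\<And>B v. B \<in> S \<Longrightarrow> v \<in> V \<Longrightarrow> B *v v \<in> V"
  shows "subgroup (affine_set S V) GLZ"
proof (rule group.subgroupI[OF group_GLZ])
  show "affine_set S V \<subseteq> carrier GLZ"
    using affine_mat_in_GLZ subgroup.subset[OF S] by (auto simp: affine_set_def)
  show "affine_set S V \<noteq> {}"
    using V(1) subgroup.one_closed[OF S] by (auto simp: affine_set_def)
next
  fix a assume "a \<in> affine_set S V"
  then obtain B v where a: "a = affine_mat B v" "B \<in> S" "v \<in> V" by (auto simp: affine_set_def)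
  let ?C = "inv\<^bsub>GLZ\<^esub> B"
  have "?C \<in> S" using a S by (simp add: subgroup.m_inv_closed)
  have "B \<in> carrier GLZ" using a(2) subgroup.subset[OF S] by blast
  then have "?C ** B = mat 1"
    using group.l_inv[OF group_GLZ] by (simp add: GLZ_simps)
  then have "affine_mat ?C (- (?C *v v)) \<otimes>\<^bsub>GLZ\<^esub> a = \<one>\<^bsub>GLZ\<^esub>"
    by (simp add: a affine_mat_mult affine_mat_one GLZ_simps)
  moreover have "?C \<in> carrier GLZ" using \<open>?C \<in> S\<close> subgroup.subset[OF S] by blast
  ultimately have "inv\<^bsub>GLZ\<^esub> a = affine_mat ?C (- (?C *v v))"
    using a \<open>B \<in> carrier GLZ\<close> affine_mat_in_GLZ by (intro group.inv_equality[OF group_GLZ]) auto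
  then show "inv\<^bsub>GLZ\<^esub> a \<in> affine_set S V"
    unfolding affine_set_def using \<open>?C \<in> S\<close> V(3) SV a by blast
next
  fix a b assume "a \<in> affine_set S V" "b \<in> affine_set S V"
  then obtain B v C w where *: "a = affine_mat B v" "b = affine_mat C w" "B \<in> S" "C \<in> S"
    "v \<in> V" "w \<in> V" by (auto simp: affine_set_def)
  then have "B ** C \<in> S" "B *v w + v \<in> V"
    using subgroup.m_closed[OF S] SV V by (auto simp: GLZ_simps)
  then show "a \<otimes>\<^bsub>GLZ\<^esub> b \<in> affine_set S V"
    by (auto simp: * GLZ_simps affine_mat_mult affine_set_def)
qed

text \<open>Conjugation by an affine map with linear part B turns the translation by v into the
  translation by B v, so stability of V under the linear parts yields normality.\<close>

lemma normal_translations: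
  assumes G: "subgroup (affine_set S W) GLZ" and N: "subgroup (affine_set {mat 1} V) GLZ"
    and sub: "affine_set {mat 1} V \<subseteq> affine_set S W"
    and SV: "\<And>B v. B \<in> S \<Longrightarrow> v \<in> V \<Longrightarrow> B *v v \<in> V"
  shows "affine_set {mat 1} V \<lhd> GLZ\<lparr>carrier := affine_set S W\<rparr>"
proof -
  let ?G = "GLZ\<lparr>carrier := affine_set S W\<rparr>"
  interpret G: group ?G by (rule subgroup.subgroup_is_group[OF G group_GLZ])
  have "subgroup (affine_set {mat 1} V) ?G"
    using group.subgroup_incl[OF group_GLZ N G sub] .
  moreover have "x \<otimes>\<^bsub>?G\<^esub> h \<otimes>\<^bsub>?G\<^esub> inv\<^bsub>?G\<^esub> x \<in> affine_set {mat 1} V"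
    if x: "x \<in> carrier ?G" and h: "h \<in> affine_set {mat 1} V" for x h
  proof -
    obtain B v w where *: "x = affine_mat B v" "B \<in> S" "h = affine_mat (mat 1) w" "w \<in> V"
      using x h by (auto simp: affine_set_def)
    let ?h = "affine_mat (mat 1) (B *v w)"
    have h': "?h \<in> affine_set {mat 1} V" using * SV by (auto simp: affine_set_def)
    \<comment> \<open>Moving \<open>x\<close> past the translation avoids computing the inverse of
      \<open>x\<close>, which then simply cancels.\<close>
    have "x \<otimes>\<^bsub>?G\<^esub> h = ?h \<otimes>\<^bsub>?G\<^esub> x"
      by (simp add: * GLZ_simps affine_mat_mult add.commute)
    then have "x \<otimes>\<^bsub>?G\<^esub> h \<otimes>\<^bsub>?G\<^esub> inv\<^bsub>?G\<^esub> x = ?h \<otimes>\<^bsub>?G\<^esub> (x \<otimes>\<^bsub>?G\<^esub> inv\<^bsub>?G\<^esub> x)"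
      using x h' sub G.inv_closed[OF x] by (subst G.m_assoc[symmetric]) auto
    also have "\<dots> = ?h" using h' sub x by (subst G.r_inv) (auto simp: GLZ_simps)
    finally show ?thesis using h' by simp
  qed
  ultimately show ?thesis using G.normal_inv_iff by blast
qed

text \<open>The composite of \<open>\<phi>\<close> with the projection to the factor group is onto,
  because every element of G lies in the coset of some value of \<open>\<phi>\<close>; an epimorphic
  image of the integers is cyclic. All three factors of the series are treated this way.\<close>

lemma cyclic_group_Mod:
  assumes N: "N \<lhd> G" and \<phi>: "\<phi> \<in> hom integer_group G"
    and gen: "\<And>g. g \<in> carrier G \<Longrightarrow> \<exists>n. \<exists>h\<in>N. g = h \<otimes>\<^bsub>G\<^esub> \<phi> n"
  shows "cyclic_group (G Mod N)"
proof -
  interpret N: normal N G by (rule N)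
  have \<phi>_closed: "\<phi> n \<in> carrier G" for n using \<phi> by (auto simp: hom_def)
  have "(\<lambda>n. N #>\<^bsub>G\<^esub> \<phi> n) \<in> epi integer_group (G Mod N)"
    unfolding epi_def
  proof (intro CollectI conjI)
    show "(\<lambda>n. N #>\<^bsub>G\<^esub> \<phi> n) \<in> hom integer_group (G Mod N)"
      using hom_compose[OF \<phi> N.r_coset_hom_Mod] by (simp add: o_def)
    have "N #>\<^bsub>G\<^esub> g \<in> range (\<lambda>n. N #>\<^bsub>G\<^esub> \<phi> n)" if g: "g \<in> carrier G" for g
    proof -
      obtain n h where "h \<in> N" "g = h \<otimes>\<^bsub>G\<^esub> \<phi> n" using gen[OF g] by blast
      moreover from this have "N #>\<^bsub>G\<^esub> h = N"
        using N.subset by (intro N.coset_join2 N.subgroup_axioms) auto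
      ultimately have "N #>\<^bsub>G\<^esub> g = N #>\<^bsub>G\<^esub> \<phi> n"
        using N.coset_mult_assoc[OF N.subset _ \<phi>_closed] N.subset by (metis subsetD)
      then show ?thesis by blast
    qed
    then show "(\<lambda>n. N #>\<^bsub>G\<^esub> \<phi> n) ` carrier integer_group = carrier (G Mod N)"
      using \<phi>_closed by (auto simp: carrier_FactGroup)
  qed
  then show ?thesis
    using group.cyclic_group_epimorphic_image[OF group_integer_group] N.factorgroup_is_group
    by simp
qed


lemma subgroup_translations:
  assumes "0 \<in> V" "\<And>v w. v \<in> V \<Longrightarrow> w \<in> V \<Longrightarrow> v + w \<in> V" "\<And>v. v \<in> V \<Longrightarrow> - v \<in> V"
  shows "subgroup (affine_set {mat 1} V) GLZ"
  using assms group.triv_subgroup[OF group_GLZ] by (intro subgroup_affine_set) (auto simp: GLZ_simps)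


section \<open>The group generated by a hyperbolic matrix and the translations\<close>

text \<open>Arnold's cat map. Determinant 1 and trace 3 give the eigenvalues (3 + sqrt 5)/2 and (3 -
  sqrt 5)/2, both off the unit circle, and by Cayley-Hamilton \<open>cat_mat\<close> and
  \<open>cat_inv\<close> add up to 3 times the identity.\<close>

definition cat_mat :: "int ^ 2 ^ 2" where
  "cat_mat = vector [vector [2, 1], vector [1, 1]]"

definition cat_inv :: "int ^ 2 ^ 2" where
  "cat_inv = vector [vector [1, -1], vector [-1, 2]]"

definition cat_powers :: "(int ^ 2 ^ 2) set" where
  "cat_powers = range (\<lambda>n::int. cat_mat [^]\<^bsub>GLZ\<^esub> n)"

definition cat_affine_group :: "(int ^ 3 ^ 3) set" where
  "cat_affine_group = affine_set cat_powers UNIV"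

lemma cat_mat_inv: "cat_mat ** cat_inv = mat 1" "cat_inv ** cat_mat = mat 1"
  by (simp_all add: cat_mat_def cat_inv_def vec_eq_iff forall_2 matrix_matrix_mult_def sum_2 mat_def)

lemma cat_in_GLZ: "cat_mat \<in> carrier GLZ" "cat_inv \<in> carrier GLZ"
  using cat_mat_inv by (auto simp: GLZ_def invertible_def)

lemma subgroup_cat_powers: "subgroup cat_powers GLZ"
  unfolding cat_powers_def by (rule group.subgroup_of_powers[OF group_GLZ cat_in_GLZ(1)])

lemma one_in_cat_powers: "mat 1 \<in> cat_powers"
  using subgroup.one_closed[OF subgroup_cat_powers] by (simp add: GLZ_simps)

lemma cat_in_cat_powers: "cat_mat \<in> cat_powers" "cat_inv \<in> cat_powers"
proof -
  show C: "cat_mat \<in> cat_powers"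
    unfolding cat_powers_def using group.int_pow_1[OF group_GLZ cat_in_GLZ(1)] by (metis rangeI)
  have "inv\<^bsub>GLZ\<^esub> cat_mat = cat_inv"
    using cat_mat_inv cat_in_GLZ by (intro group.inv_equality[OF group_GLZ]) (auto simp: GLZ_simps)
  then show "cat_inv \<in> cat_powers"
    using subgroup.m_inv_closed[OF subgroup_cat_powers C] by simp
qed

lemma subgroup_cat_affine_group: "subgroup cat_affine_group GLZ"
  unfolding cat_affine_group_def by (rule subgroup_affine_set[OF subgroup_cat_powers]) auto

lemma polycyclic_cat_affine_group: "polycyclic_group (GLZ\<lparr>carrier := cat_affine_group\<rparr>)"
proof -
  let ?G = "GLZ\<lparr>carrier := cat_affine_group\<rparr>"
  \<comment> \<open>This line is not stable under \<open>cat_mat\<close>, which sends (1, 0) to (2,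
    1). Each term has to be normal only in the next one, and for this line the next term consists of
    translations, whose linear part is trivial.\<close>
  let ?V = "{v :: int ^ 2. v $ 2 = 0}"
  \<comment> \<open>From index 3 on the series is constant, so \<open>sub\<close> and
    \<open>H_sub\<close> hold for every index.\<close>
  define H where "H i = (if i = 0 then affine_set {mat 1} {0} else if i = 1 then affine_set {mat 1} ?V
    else if i = 2 then affine_set {mat 1} UNIV else cat_affine_group)" for i :: nat
  have H_simps: "H 0 = affine_set {mat 1} {0}" "H (Suc 0) = affine_set {mat 1} ?V"
    "H (Suc (Suc 0)) = affine_set {mat 1} UNIV" "H (Suc (Suc (Suc 0))) = cat_affine_group"
    by (simp_all add: H_def)
  have sub: "subgroup (H i) GLZ" for i
    using subgroup_cat_affine_group by (auto simp: H_def intro: subgroup_translations)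
  have mono: "affine_set {mat 1} V \<subseteq> affine_set S W" if "mat 1 \<in> S" "V \<subseteq> W" for V S W
    using that by (auto simp: affine_set_def)
  have H_sub: "H i \<subseteq> cat_affine_group" for i
    using one_in_cat_powers mono by (auto simp: H_def cat_affine_group_def)
  have step: "H i \<lhd> GLZ\<lparr>carrier := H (Suc i)\<rparr> \<and> cyclic_group (GLZ\<lparr>carrier := H (Suc i)\<rparr> Mod H i)"
    if "i < 3" for i
  proof -
    consider "i = 0" | "i = 1" | "i = 2" using \<open>i < 3\<close> by linarith
    then show ?thesis
    proof cases
      case 1
      let ?\<phi> = "\<lambda>n. affine_mat (mat 1) (vector [n, 0])"
      have N: "H 0 \<lhd> GLZ\<lparr>carrier := H (Suc 0)\<rparr>"
        using sub[of 0] sub[of "Suc 0"] mono unfolding H_simps by (intro normal_translations) auto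
      moreover have "cyclic_group (GLZ\<lparr>carrier := H (Suc 0)\<rparr> Mod H 0)"
      proof (rule cyclic_group_Mod[OF N, of ?\<phi>])
        \<comment> \<open>The summands are swapped to match \<open>affine_mat_mult\<close>, which
          puts the translation part of the left factor last.\<close>
        have add: "vector [m + n, 0] = (vector [n, 0] + vector [m, 0] :: int ^ 2)" for m n
          by (simp add: vec_eq_iff forall_2)
        have "?\<phi> n \<in> H (Suc 0)" for n
          by (auto simp: H_simps affine_set_def)
        then show "?\<phi> \<in> hom integer_group (GLZ\<lparr>carrier := H (Suc 0)\<rparr>)"
          by (simp add: hom_def GLZ_simps affine_mat_mult add)
        fix g assume "g \<in> carrier (GLZ\<lparr>carrier := H (Suc 0)\<rparr>)"
        then obtain v where v: "g = affine_mat (mat 1) v" "v $ 2 = 0"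
          by (auto simp: H_simps affine_set_def)
        then have "v = vector [v $ 1, 0]" by (simp add: vec_eq_iff forall_2)
        then have "g = affine_mat (mat 1) 0 \<otimes>\<^bsub>GLZ\<lparr>carrier := H (Suc 0)\<rparr>\<^esub> ?\<phi> (v $ 1)"
          using v by (simp add: GLZ_simps affine_mat_mult)
        then show "\<exists>n. \<exists>h\<in>H 0. g = h \<otimes>\<^bsub>GLZ\<lparr>carrier := H (Suc 0)\<rparr>\<^esub> ?\<phi> n"
          by (auto simp: H_simps affine_set_def)
      qed
      ultimately show ?thesis using 1 by simp
    next
      case 2
      let ?\<phi> = "\<lambda>n. affine_mat (mat 1) (vector [0, n])"
      have N: "H 1 \<lhd> GLZ\<lparr>carrier := H (Suc 1)\<rparr>"
        using sub[of 1] sub[of "Suc 1"] mono unfolding One_nat_def H_simps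
        by (intro normal_translations) auto
      moreover have "cyclic_group (GLZ\<lparr>carrier := H (Suc 1)\<rparr> Mod H 1)"
      proof (rule cyclic_group_Mod[OF N, of ?\<phi>])
        have add: "vector [0, m + n] = (vector [0, n] + vector [0, m] :: int ^ 2)" for m n
          by (simp add: vec_eq_iff forall_2)
        have "?\<phi> n \<in> H (Suc 1)" for n
          by (auto simp: H_simps affine_set_def)
        then show "?\<phi> \<in> hom integer_group (GLZ\<lparr>carrier := H (Suc 1)\<rparr>)"
          by (simp add: hom_def GLZ_simps affine_mat_mult add)
        fix g assume "g \<in> carrier (GLZ\<lparr>carrier := H (Suc 1)\<rparr>)"
        then obtain v where v: "g = affine_mat (mat 1) v"
          by (auto simp: H_simps affine_set_def)
        have "v = vector [0, v $ 2] + vector [v $ 1, 0]" by (simp add: vec_eq_iff forall_2)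
        then have "g = affine_mat (mat 1) (vector [v $ 1, 0])
            \<otimes>\<^bsub>GLZ\<lparr>carrier := H (Suc 1)\<rparr>\<^esub> ?\<phi> (v $ 2)"
          using v by (simp add: GLZ_simps affine_mat_mult)
        moreover have "affine_mat (mat 1) (vector [v $ 1, 0]) \<in> H 1"
          by (auto simp: H_simps affine_set_def)
        ultimately show "\<exists>n. \<exists>h\<in>H 1. g = h \<otimes>\<^bsub>GLZ\<lparr>carrier := H (Suc 1)\<rparr>\<^esub> ?\<phi> n"
          by blast
      qed
      ultimately show ?thesis using 2 by simp
    next
      case 3
      let ?\<phi> = "\<lambda>n::int. affine_mat (cat_mat [^]\<^bsub>GLZ\<^esub> n) 0"
      have N: "H 2 \<lhd> GLZ\<lparr>carrier := H (Suc 2)\<rparr>"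
        using sub[of 2] sub[of "Suc 2"] mono one_in_cat_powers
        unfolding numeral_2_eq_2 H_simps cat_affine_group_def
        by (intro normal_translations) auto
      moreover have "cyclic_group (GLZ\<lparr>carrier := H (Suc 2)\<rparr> Mod H 2)"
      proof (rule cyclic_group_Mod[OF N, of ?\<phi>])
        have "cat_mat [^]\<^bsub>GLZ\<^esub> (m + n) = cat_mat [^]\<^bsub>GLZ\<^esub> m ** cat_mat [^]\<^bsub>GLZ\<^esub> n" for m n :: int
          using group.int_pow_mult[OF group_GLZ cat_in_GLZ(1)] by (simp add: GLZ_simps)
        then show "?\<phi> \<in> hom integer_group (GLZ\<lparr>carrier := H (Suc 2)\<rparr>)"
          by (auto simp: hom_def numeral_2_eq_2 H_simps cat_affine_group_def affine_set_def
              cat_powers_def GLZ_simps affine_mat_mult)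
        fix g assume "g \<in> carrier (GLZ\<lparr>carrier := H (Suc 2)\<rparr>)"
        then obtain n :: int and v where v: "g = affine_mat (cat_mat [^]\<^bsub>GLZ\<^esub> n) v"
          by (auto simp: numeral_2_eq_2 H_simps cat_affine_group_def affine_set_def cat_powers_def)
        \<comment> \<open>An affine map is its linear part followed by its translation part.\<close>
        then have "g = affine_mat (mat 1) v \<otimes>\<^bsub>GLZ\<lparr>carrier := H (Suc 2)\<rparr>\<^esub> ?\<phi> n"
          by (simp add: GLZ_simps affine_mat_mult)
        moreover have "affine_mat (mat 1) v \<in> H 2"
          by (auto simp: numeral_2_eq_2 H_simps affine_set_def)
        ultimately show "\<exists>n. \<exists>h\<in>H 2. g = h \<otimes>\<^bsub>GLZ\<lparr>carrier := H (Suc 2)\<rparr>\<^esub> ?\<phi> n" by blast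
      qed
      ultimately show ?thesis using 3 by simp
    qed
  qed
  show ?thesis
    unfolding polycyclic_group_def
  proof (intro conjI exI[of _ H] exI[of _ 3] allI impI)
    show "group ?G"
      by (rule subgroup.subgroup_is_group[OF subgroup_cat_affine_group group_GLZ])
    show "H 0 = {\<one>\<^bsub>?G\<^esub>}" by (auto simp: H_def affine_set_def affine_mat_one GLZ_simps)
    show "H 3 = carrier ?G" by (simp add: H_def)
    show "subgroup (H i) ?G" for i
      by (rule group.subgroup_incl[OF group_GLZ sub subgroup_cat_affine_group H_sub])
    fix i :: nat assume "i < 3"
    from step[OF this] show "H i \<lhd> ?G\<lparr>carrier := H (Suc i)\<rparr>"
      "cyclic_group (?G\<lparr>carrier := H (Suc i)\<rparr> Mod H i)" by simp_all
  qed
qed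

section \<open>Expansiveness\<close>

lemma Ints_less_one_eq_0:
  fixes r :: real
  assumes "r \<in> \<int>" "\<bar>r\<bar> < 1" shows "r = 0"
  using assms by (auto elim!: Ints_cases)

lemma expansive_cat_affine_group:
  "expansive_action (GLZ\<lparr>carrier := cat_affine_group\<rparr>) (natural_action :: _ \<Rightarrow> 3 torus \<Rightarrow> _)"
proof -
  let ?G = "cat_affine_group"
  \<comment> \<open>With the bound 1/8 the images of points of \<open>?B\<close> under the matrices
    used have coordinates below 3/8, well within the 7/8 that \<open>lift\<close> asks for. That 7/8
    in turn comes from 7/8 + 1/8 = 1, the smallest positive integer.\<close>
  let ?B = "{x :: real ^ 3. \<forall>i. \<bar>x $ i\<bar> < 1/8}"
  let ?U = "abs_torus ` ?B :: 3 torus set"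
  have "?B = (\<Inter>i. {x. \<bar>x $ i\<bar> < 1/8})" by auto
  moreover have "open (\<Inter>i::3. {x :: real ^ 3. \<bar>x $ i\<bar> < 1/8})"
    by (intro open_INT ballI open_Collect_less continuous_intros) auto
  ultimately have "open ?U" by (metis open_abs_torus_image)
  moreover have zero: "0 \<in> ?U" by (rule image_eqI[of _ _ 0]) (auto simp: zero_torus_def)
  ultimately have "0 \<in> interior ?U" by (simp add: interior_open)
  moreover have "x = 0" if x: "x \<in> (\<Inter>g\<in>?G. natural_action g ` ?U)" for x
  proof -
    \<comment> \<open>Membership of \<open>x\<close> in the image of \<open>?U\<close> under the
      inverse of \<open>g\<close> says that \<open>g\<close> moves \<open>x\<close> into
      \<open>?U\<close>. The group is closed under inverses, so the whole orbit of \<open>x\<close>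
      lies in \<open>?U\<close>.\<close>
    have orbit: "natural_action g x \<in> ?U" if g: "g \<in> ?G" for g
    proof -
      let ?h = "inv\<^bsub>GLZ\<^esub> g"
      have "?h \<in> ?G" using g subgroup.m_inv_closed[OF subgroup_cat_affine_group] by blast
      then obtain u where "u \<in> ?U" "x = natural_action ?h u" using x by blast
      moreover have "natural_action g (natural_action ?h u) = u"
        using g subgroup.subset[OF subgroup_cat_affine_group] by (intro natural_action_inv) blast
      ultimately show ?thesis by simp
    qed
    \<comment> \<open>\<open>Q\<close> describes the lifts in \<open>?B\<close> of all orbit points,
      not only of \<open>x\<close>. The inductions below need this generality: they apply a bound
      for every orbit point to the images of a given one.\<close>
    define Q where "Q y \<longleftrightarrow> (\<exists>g\<in>?G. natural_action g x = abs_torus y) \<and> y \<in> ?B" for y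
    \<comment> \<open>Two lifts of the same point that are both close to 0 coincide, so the orbit lifts to an
      orbit of the linear action as long as the matrices applied are not too large.\<close>
    have lift: "Q (map_matrix real_of_int g *v y)"
      if y: "Q y" and g: "g \<in> ?G" and small: "\<And>i. \<bar>(map_matrix real_of_int g *v y) $ i\<bar> < 7/8"
      for g y
    proof -
      obtain h where h: "h \<in> ?G" "natural_action h x = abs_torus y" using y by (auto simp: Q_def)
      have gh: "g ** h \<in> ?G"
        using subgroup.m_closed[OF subgroup_cat_affine_group g h(1)] by (simp add: GLZ_simps)
      have eq: "natural_action (g ** h) x = abs_torus (map_matrix real_of_int g *v y)"
        by (simp add: natural_action_mult h natural_action_abs_torus)
      obtain z where z: "z \<in> ?B" "natural_action (g ** h) x = abs_torus z"
        using orbit[OF gh] by blast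
      have "(map_matrix real_of_int g *v y) $ i = z $ i" for i
      proof -
        have "(map_matrix real_of_int g *v y) $ i - z $ i \<in> \<int>"
          using eq z(2) by (metis abs_torus_eq_iff)
        moreover have "\<bar>z $ i\<bar> < 1/8" using z(1) by simp
        then have "\<bar>(map_matrix real_of_int g *v y) $ i - z $ i\<bar> < 1" using small[of i] by linarith
        ultimately show ?thesis using Ints_less_one_eq_0 by fastforce
      qed
      then have "map_matrix real_of_int g *v y = z" by (simp add: vec_eq_iff)
      then show ?thesis using z gh by (auto simp: Q_def)
    qed
    have bound: "\<bar>y $ i\<bar> < 1/8" if "Q y" for y i using that by (simp add: Q_def)
    have third: "y $ 3 = 0" if y: "Q y" for y
    proof -
      let ?t = "affine_mat (mat 1) (vector [1, 0])"
      have t: "?t \<in> ?G"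
        using one_in_cat_powers by (auto simp: cat_affine_group_def affine_set_def)
      have t_act: "map_matrix real_of_int ?t *v z = vector [z $ 1 + z $ 3, z $ 2, z $ 3]" for z
        by (simp add: affine_mat_action mat_def)
      \<comment> \<open>One shear is applied at a time: the n-fold shear is not known beforehand to
        keep the coordinates below 7/8, but a single shear of a point already known to lie in
        \<open>?B\<close> does.\<close>
      have "Q (vector [y $ 1 + real n * y $ 3, y $ 2, y $ 3])" for n
      proof (induction n)
        case 0
        have "vector [y $ 1, y $ 2, y $ 3] = y" by (simp add: vec_eq_iff forall_3)
        then show ?case using y by simp
      next
        case (Suc n)
        let ?z = "vector [y $ 1 + real n * y $ 3, y $ 2, y $ 3] :: real ^ 3"
        have "\<bar>?z $ 1\<bar> < 1/8" "\<bar>?z $ 2\<bar> < 1/8" "\<bar>?z $ 3\<bar> < 1/8" using bound[OF Suc] by blast+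
        then have "\<bar>?z $ 1 + ?z $ 3\<bar> < 7/8" "\<bar>?z $ 2\<bar> < 7/8" "\<bar>?z $ 3\<bar> < 7/8" by linarith+
        then have "\<bar>(map_matrix real_of_int ?t *v ?z) $ i\<bar> < 7/8" for i
          unfolding t_act using exhaust_3[of i] by auto
        from lift[OF Suc t this] show ?case by (simp add: t_act algebra_simps)
      qed
      from bound[OF this, of _ 1] have shear: "\<bar>y $ 1 + real n * y $ 3\<bar> < 1/8" for n by simp
      have n: "real n * \<bar>y $ 3\<bar> < 1" for n
      proof -
        have "\<bar>real n * y $ 3\<bar> < 1" using shear[of n] bound[OF y, of 1] by linarith
        then show ?thesis by (simp add: abs_mult)
      qed
      show ?thesis
      proof (rule ccontr)
        assume "y $ 3 \<noteq> 0"
        then obtain n where "1 < real n * \<bar>y $ 3\<bar>" using ex_less_of_nat_mult by (metis zero_less_abs_iff)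
        then show False using n[of n] by simp
      qed
    qed
    \<comment> \<open>The trace of the hyperbolic matrix is 3, so the sum of the images of \<open>y\<close> under it and its
      inverse is \<open>3 y\<close>: a bound for all orbit points improves to two thirds of itself.\<close>
    have contract: "\<forall>y. Q y \<longrightarrow> \<bar>y $ 1\<bar> \<le> (2/3) ^ k \<and> \<bar>y $ 2\<bar> \<le> (2/3) ^ k" for k :: nat
    proof (induction k)
      case 0
      have "\<bar>y $ i\<bar> \<le> 1" if "Q y" for y i using bound[OF that, of i] by linarith
      then show ?case by simp
    next
      case (Suc k)
      show ?case
      proof (intro allI impI)
        fix y assume y: "Q y"
        have b: "\<bar>y $ 1\<bar> < 1/8" "\<bar>y $ 2\<bar> < 1/8" using bound[OF y] by blast+
        let ?p = "affine_mat cat_mat 0" and ?q = "affine_mat cat_inv 0"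
        have pq: "?p \<in> ?G" "?q \<in> ?G"
          using cat_in_cat_powers by (auto simp: cat_affine_group_def affine_set_def)
        have p_act: "map_matrix real_of_int ?p *v y = vector [2 * y $ 1 + y $ 2, y $ 1 + y $ 2, y $ 3]"
          by (simp add: affine_mat_action cat_mat_def)
        have q_act: "map_matrix real_of_int ?q *v y = vector [y $ 1 - y $ 2, 2 * y $ 2 - y $ 1, y $ 3]"
          by (simp add: affine_mat_action cat_inv_def)
        have small: "\<bar>2 * y $ 1 + y $ 2\<bar> < 7/8" "\<bar>y $ 1 + y $ 2\<bar> < 7/8"
          "\<bar>y $ 1 - y $ 2\<bar> < 7/8" "\<bar>2 * y $ 2 - y $ 1\<bar> < 7/8"
          using b by linarith+
        have "\<bar>(map_matrix real_of_int ?p *v y) $ i\<bar> < 7/8"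
          "\<bar>(map_matrix real_of_int ?q *v y) $ i\<bar> < 7/8" for i
          unfolding p_act q_act using exhaust_3[of i] small third[OF y] by auto
        from lift[OF y pq(1) this(1)] lift[OF y pq(2) this(2)] Suc.IH
        have "\<bar>2 * y $ 1 + y $ 2\<bar> \<le> (2/3) ^ k" "\<bar>y $ 1 + y $ 2\<bar> \<le> (2/3) ^ k"
          "\<bar>y $ 1 - y $ 2\<bar> \<le> (2/3) ^ k" "\<bar>2 * y $ 2 - y $ 1\<bar> \<le> (2/3) ^ k"
          unfolding p_act q_act by fastforce+
        then show "\<bar>y $ 1\<bar> \<le> (2/3) ^ Suc k \<and> \<bar>y $ 2\<bar> \<le> (2/3) ^ Suc k"
          by (auto simp: abs_le_iff)
      qed
    qed
    have vanish: "r = 0" if "\<And>k::nat. \<bar>r\<bar> \<le> (2/3) ^ k" for r :: real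
    proof -
      have "(\<lambda>k. (2/3::real) ^ k) \<longlonglongrightarrow> 0" by (rule LIMSEQ_realpow_zero) auto
      from LIMSEQ_le_const[OF this, of "\<bar>r\<bar>"] that show ?thesis by auto
    qed
    have one: "mat 1 \<in> ?G"
      using subgroup.one_closed[OF subgroup_cat_affine_group] by (simp add: GLZ_simps)
    obtain y where y: "y \<in> ?B" "x = abs_torus y"
      using orbit[OF one] by (auto simp: natural_action_one)
    then have Qy: "Q y" using one unfolding Q_def by (metis natural_action_one id_apply)
    then have "y $ 1 = 0" "y $ 2 = 0" "y $ 3 = 0" using contract third vanish by blast+
    then have "y = 0" by (simp add: vec_eq_iff forall_3)
    then show ?thesis using y by (simp add: zero_torus_def)
  qed
  moreover have "natural_action g (0 :: 3 torus) = 0" for g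
    using natural_action_add[of g 0 0] by simp
  then have "0 \<in> natural_action g ` ?U" for g
    using imageI[OF zero, of "natural_action g"] by simp
  then have "0 \<in> (\<Inter>g\<in>?G. natural_action g ` ?U)" by (intro INT_I)
  ultimately have "(\<Inter>g\<in>?G. natural_action g ` ?U) = {0}" by blast
  with \<open>0 \<in> interior ?U\<close> show ?thesis
    unfolding expansive_action_def by (intro exI[of _ ?U]) simp
qed

section \<open>The two-dimensional subtorus on whose cosets the group acts trivially\<close>

definition fibre_torus :: "3 torus set" where
  "fibre_torus = abs_torus ` {x. x $ 3 \<in> \<int>}"

text \<open>Two lifts of a point differ by integers in the third coordinate, so membership can be
  tested on any lift.\<close>

lemma abs_torus_in_fibre_iff: "abs_torus x \<in> fibre_torus \<longleftrightarrow> x $ 3 \<in> \<int>"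
proof
  assume "abs_torus x \<in> fibre_torus"
  then obtain y :: "real ^ 3" where "y $ 3 \<in> \<int>" "\<forall>i. x $ i - y $ i \<in> \<int>"
    by (auto simp: fibre_torus_def abs_torus_eq_iff)
  then show "x $ 3 \<in> \<int>" by (metis Ints_add diff_add_cancel)
qed (auto simp: fibre_torus_def)

text \<open>The bottom row of every \<open>affine_mat\<close> is (0, 0, 1). This one fact gives the
  invariance of the subtorus, the trivial quotient and the failure of ergodicity.\<close>

lemma cat_affine_group_third:
  assumes "g \<in> cat_affine_group"
  shows "(map_matrix real_of_int g *v x) $ 3 = x $ 3"
  using assms by (auto simp: cat_affine_group_def affine_set_def affine_mat_action)

lemma closed_invariant_fibre_torus:
  "closed_invariant_subgroup (GLZ\<lparr>carrier := cat_affine_group\<rparr>) natural_action fibre_torus"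
  unfolding closed_invariant_subgroup_def
proof (intro conjI ballI)
  have "closed ((\<lambda>x :: real ^ 3. x $ 3) -` \<int>)"
    by (intro closed_vimage closed_Ints continuous_intros)
  moreover have "abs_torus -` (- fibre_torus) = - ((\<lambda>x. x $ 3) -` \<int>)"
    by (auto simp: abs_torus_in_fibre_iff)
  ultimately show "closed fibre_torus" by (simp add: closed_def open_torus_def)
  show "0 \<in> fibre_torus" by (simp add: zero_torus_def abs_torus_in_fibre_iff)
  fix s assume s: "s \<in> fibre_torus"
  then obtain x where x: "s = abs_torus x" "x $ 3 \<in> \<int>" by (auto simp: fibre_torus_def)
  then show "- s \<in> fibre_torus" by (auto simp: abs_torus_in_fibre_iff simp flip: abs_torus_minus)
  fix t assume "t \<in> fibre_torus"
  then obtain y where "t = abs_torus y" "y $ 3 \<in> \<int>" by (auto simp: fibre_torus_def)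
  with x show "s + t \<in> fibre_torus" by (auto simp: abs_torus_in_fibre_iff simp flip: abs_torus_add)
next
  fix g assume "g \<in> carrier (GLZ\<lparr>carrier := cat_affine_group\<rparr>)"
  then show "natural_action g ` fibre_torus \<subseteq> fibre_torus"
    by (auto simp: fibre_torus_def natural_action_abs_torus cat_affine_group_third)
qed

lemma trivial_on_quotient_fibre_torus:
  "trivial_on_quotient (GLZ\<lparr>carrier := cat_affine_group\<rparr>) natural_action fibre_torus"
  unfolding trivial_on_quotient_def
proof (intro ballI)
  fix g C assume g: "g \<in> carrier (GLZ\<lparr>carrier := cat_affine_group\<rparr>)" and "C \<in> cosets fibre_torus"
  then obtain t where C: "C = t +o fibre_torus" by (auto simp: cosets_def)
  have K: "0 \<in> fibre_torus" "\<And>s t. s \<in> fibre_torus \<Longrightarrow> t \<in> fibre_torus \<Longrightarrow> s + t \<in> fibre_torus"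
    "\<And>s. s \<in> fibre_torus \<Longrightarrow> - s \<in> fibre_torus" "natural_action g ` fibre_torus \<subseteq> fibre_torus"
    using closed_invariant_fibre_torus g by (auto simp: closed_invariant_subgroup_def)
  obtain x where x: "t = abs_torus x" using abs_torus_surj by blast
  \<comment> \<open>The displacement of the lift has third coordinate 0, so \<open>t\<close> and its
    image lie in the same coset.\<close>
  define k where "k = abs_torus (map_matrix real_of_int g *v x - x)"
  have k: "k \<in> fibre_torus"
    using g by (simp add: k_def abs_torus_in_fibre_iff cat_affine_group_third)
  have "natural_action g t = t + k"
    by (simp add: k_def x natural_action_abs_torus flip: abs_torus_add)
  moreover have "(t + k) +o fibre_torus = t +o fibre_torus"
  proof (intro equalityI subsetI)
    fix s assume "s \<in> (t + k) +o fibre_torus"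
    then show "s \<in> t +o fibre_torus"
      using K(2)[OF k] by (auto simp: elt_set_plus_def add.assoc)
  next
    fix s assume "s \<in> t +o fibre_torus"
    then obtain l where l: "l \<in> fibre_torus" "s = t + l" by (auto simp: elt_set_plus_def)
    then have "s = (t + k) + (- k + l)" by simp
    then show "s \<in> (t + k) +o fibre_torus"
      using K(2)[OF K(3)[OF k] l(1)] unfolding elt_set_plus_def by blast
  qed
  ultimately show "induced_map (natural_action g) fibre_torus C = C"
    using induced_map_coset[OF K(1,2,4) natural_action_add] C by simp
qed

section \<open>Failure of ergodicity\<close>

lemma not_ergodic_cat_affine_group:
  "\<not> ergodic_action (GLZ\<lparr>carrier := cat_affine_group\<rparr>) (natural_action :: _ \<Rightarrow> 3 torus \<Rightarrow> _)"
proof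
  assume erg: "ergodic_action (GLZ\<lparr>carrier := cat_affine_group\<rparr>) (natural_action :: _ \<Rightarrow> 3 torus \<Rightarrow> _)"
  \<comment> \<open>Any set of values of the third coordinate pulls back from the trivial quotient
    circle to an invariant set. An open half circle gives measure 1/2, strictly between 0 and
    1.\<close>
  let ?S = "{x :: real ^ 3. 0 < x $ 3 \<and> x $ 3 < 1/2}"
  let ?E = "abs_torus ` ?S"
  have "open ?S"
    by (intro open_Collect_conj open_Collect_less continuous_on_const continuous_on_component
        continuous_on_id)
  then have E: "?E \<in> sets borel" by (intro borel_open open_abs_torus_image)
  have sub: "natural_action g ` ?E \<subseteq> ?E" if "g \<in> cat_affine_group" for g
    using cat_affine_group_third[OF that] by (auto simp: natural_action_abs_torus)
  have inv: "natural_action g ` ?E = ?E" if g: "g \<in> cat_affine_group" for g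
  proof
    let ?h = "inv\<^bsub>GLZ\<^esub> g"
    have h: "?h \<in> cat_affine_group"
      using g subgroup.m_inv_closed[OF subgroup_cat_affine_group] by blast
    have gh: "natural_action g (natural_action ?h t) = t" for t :: "3 torus"
      using g subgroup.subset[OF subgroup_cat_affine_group] by (intro natural_action_inv) blast
    show "?E \<subseteq> natural_action g ` ?E"
    proof
      fix t assume "t \<in> ?E"
      then have "natural_action ?h t \<in> ?E" using sub[OF h] by blast
      then show "t \<in> natural_action g ` ?E"
        using image_eqI[of t "natural_action g" "natural_action ?h t"] gh by simp
    qed
  qed (rule sub[OF g])
  \<comment> \<open>Haar measure is computed on the unit cube. A point there and a lift in
    \<open>?S\<close> have third coordinates in [0, 1) and (0, 1/2), so their integer difference is
    0.\<close>
  have "abs_torus -` ?E \<inter> unit_cube = {x \<in> unit_cube. 0 < x $ 3 \<and> x $ 3 < 1/2}" (is "?L = ?R")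
  proof (intro equalityI subsetI)
    fix x assume x: "x \<in> ?L"
    then obtain y :: "real ^ 3" where y: "0 < y $ 3" "y $ 3 < 1/2" "x $ 3 - y $ 3 \<in> \<int>"
      by (auto simp: abs_torus_eq_iff)
    moreover have "0 \<le> x $ 3" "x $ 3 < 1" using x by (auto simp: unit_cube_def)
    ultimately have "x $ 3 - y $ 3 = 0" by (intro Ints_less_one_eq_0) auto
    then show "x \<in> ?R" using x y by auto
  qed auto
  moreover have m: "abs_torus \<in> measurable (restrict_space lborel unit_cube) borel"
    by (intro measurable_restrict_space1) simp
  have "emeasure haar ?E = emeasure lborel (abs_torus -` ?E \<inter> unit_cube)"
    unfolding haar_torus emeasure_distr[OF m E]
    by (simp add: emeasure_restrict_space space_restrict_space)
  ultimately have haar_E: "emeasure haar ?E = emeasure lborel ?R" by metis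
  let ?c = "vector [1, 1, 1/2] :: real ^ 3"
  have Basis: "(Basis :: (real ^ 3) set) = {axis 1 1, axis 2 1, axis 3 1}"
    by (auto simp: Basis_vec_def UNIV_3)
  have prod: "(\<Prod>b\<in>Basis. (?c - 0) \<bullet> b) = 1/2"
    by (simp add: Basis inner_axis axis_eq_axis)
  have le: "\<And>b. b \<in> Basis \<Longrightarrow> 0 \<bullet> b \<le> ?c \<bullet> b"
    by (auto simp: Basis inner_axis)
  have R: "?R \<in> sets lborel"
    using sets.Int[OF unit_cube_measurable borel_open[OF \<open>open ?S\<close>]] by (simp add: Int_def)
  \<comment> \<open>In the first two coordinates \<open>?R\<close> is half-open, hence it is
    squeezed between the open and the closed box with the same corners.\<close>
  have "emeasure lborel ?R = ennreal (1/2)"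
  proof (rule order.antisym)
    have "emeasure lborel ?R \<le> emeasure lborel (cbox 0 ?c)"
      by (intro emeasure_mono) (auto simp: unit_cube_def mem_box_cart forall_3)
    also have "\<dots> = ennreal (1/2)" using emeasure_lborel_cbox[OF le] unfolding prod .
    finally show "emeasure lborel ?R \<le> ennreal (1/2)" .
    have "ennreal (1/2) = emeasure lborel (box 0 ?c)"
      using emeasure_lborel_box[OF le] unfolding prod by (rule sym)
    also have "\<dots> \<le> emeasure lborel ?R"
      using R by (intro emeasure_mono) (auto simp: unit_cube_def mem_box_cart forall_3)
    finally show "ennreal (1/2) \<le> emeasure lborel ?R" .
  qed
  moreover have "emeasure haar ?E = 0 \<or> emeasure haar ?E = 1"
  proof -
    have "(natural_action g ` ?E - ?E) \<union> (?E - natural_action g ` ?E) \<in> null_sets haar"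
      if "g \<in> cat_affine_group" for g
      unfolding inv[OF that] by simp
    then show ?thesis using erg E unfolding ergodic_action_def by simp
  qed
  moreover have "ennreal (1/2) \<noteq> 0" by (subst ennreal_eq_0_iff) simp
  moreover have "ennreal (1/2) \<noteq> 1" by (subst ennreal_eq_1) simp
  ultimately show False unfolding haar_E by metis
qed

theorem mainTheorem2:
  shows "\<exists>\<Gamma> :: (int ^ 3 ^ 3) set.
    subgroup \<Gamma> GLZ \<and>
    polycyclic_group (GLZ\<lparr>carrier := \<Gamma>\<rparr>) \<and>
    algebraic_action (GLZ\<lparr>carrier := \<Gamma>\<rparr>) (natural_action :: int ^ 3 ^ 3 \<Rightarrow> 3 torus \<Rightarrow> 3 torus) \<and>
    expansive_action (GLZ\<lparr>carrier := \<Gamma>\<rparr>) (natural_action :: int ^ 3 ^ 3 \<Rightarrow> 3 torus \<Rightarrow> 3 torus) \<and>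
    (\<exists>K :: 3 torus set.
       closed_invariant_subgroup (GLZ\<lparr>carrier := \<Gamma>\<rparr>) natural_action K \<and>
       K \<subset> UNIV \<and>
       trivial_on_quotient (GLZ\<lparr>carrier := \<Gamma>\<rparr>) natural_action K) \<and>
    connected (UNIV :: 3 torus set) \<and>
    \<not> ergodic_action (GLZ\<lparr>carrier := \<Gamma>\<rparr>) (natural_action :: int ^ 3 ^ 3 \<Rightarrow> 3 torus \<Rightarrow> 3 torus)"
proof (intro exI[of _ cat_affine_group] exI[of _ fibre_torus] conjI)
  have "(1/2 :: real) \<notin> \<int>" by (auto elim!: Ints_cases simp: field_simps)
  then have "abs_torus (vector [0, 0, 1/2]) \<notin> fibre_torus" by (simp add: abs_torus_in_fibre_iff)
  then show "fibre_torus \<subset> UNIV" by auto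
qed (intro subgroup_cat_affine_group polycyclic_cat_affine_group expansive_cat_affine_group
  algebraic_action_natural_action closed_invariant_fibre_torus trivial_on_quotient_fibre_torus
  connected_torus not_ergodic_cat_affine_group)+

end
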